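(* Let $(K,d)$ be a vertically positive double complex whose differential is of the form $d=d_{10}+d_{-12}=:d'+d''$, and let $(E_r,d_r)_{r\in\mathbb{N}}$ be the spectral sequence associated with $K$ filtered by the horizontal filtration. This spectral sequence admits the following model, where $\overline{d}_s:=I_s d_s I_s^{-1}$ for every $s\in\mathbb{N}$. The map $I_0:E_0^{pq}\ni[\sum_{i=0}^{q}z^{q-i,p+i}]_{E_0^{pq}}\mapsto z^{qp}\in K^{qp}$ is an isomorphism of bigraded vector spaces, and $\overline{d}_0=d_{10}=d'$. For any $r\in\{1,2,\ldots\}$: (i) The map $$I_{2r-1}:E_{2r-1}^{pq}\ni\Big[\mathfrak{z}_{2r-1}^{pq}=\sum_{i=0}^{q}z^{q-i,p+i}\Big]_{E_{2r-1}^{pq}}\mapsto [[[z^{qp}]_0]_1\ldots]_{r-1}\in {}^{r-1}\!H^{pq}({}^{r-2}\!H(\ldots({}^0\!H(K))))$$ is a bigraded vector space isomorphism. Its inverse $I_{2r-1}^{-1}$ associates to any class $[[[z^{qp}]_0]_1\ldots]_{r-1}$ of the target the class in $E_{2r-1}^{pq}$ with representative $\mathfrak{z}_{2r-1}^{pq}=\sum_{i=0}^{r-1}z^{q-2i,p+2i}$, where $(z^{qp},\ldots,z^{q-2(r-1),p+2(r-1)})$ is any solution of the system $S(z^{qp};r)$. Furthermore, $\overline{d}_{2r-1}=0$. (ii) The model of $E_{2r}^{pq}$ and the corresponding isomorphisms $I_{2r}$ and $I_{2r}^{-1}$ coincide with those pertaining to $E_{2r-1}^{pq}$. Moreover, $$\overline{d}_{2r}[[[z^{qp}]_0]_1\ldots]_{r-1}=[[[d''z^{q-2(r-1),p+2(r-1)}]_0]_1\ldots]_{r-1},$$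 where $z^{q-2(r-1),p+2(r-1)}$ is the last entry of an arbitrary solution of $S(z^{qp};r)$.
   Context: Vertically positive double complex (VPDC): a complex $(K,d)$ of vector spaces with $K=\bigoplus_{n\in\mathbb{N}}K^n$, $d:K^n\to K^{n+1}$, $d^2=0$, and $K^n=\bigoplus_{r,s\in\mathbb{N},\,r+s=n}K^{rs}$ (set $K^{rs}=0$ if $r<0$ or $s<0$). The differential decomposes as $d=\sum_{a+b=1}d_{ab}$ with $d_{ab}:K^{pq}\to K^{p+a,q+b}$, $a,b\in\mathbb{Z}$, and one requires $d_{ab}=0$ for all $b<0$. Here moreover $d=d_{10}+d_{-12}=d'+d''$, so that $d'^2=d''^2=d'd''+d''d'=0$. Horizontal filtration: $K_p=\bigoplus_{r\in\mathbb{N},\,s\ge p}K^{rs}$. Spectral sequence: $E_r^{pq}=Z_r^{pq}/(Z_{r-1}^{p+1,q-1}+B_{r-1}^{pq})$, with $Z_r^{pq}=K_p\cap d^{-1}K_{p+r}\cap K^{p+q}$, $B_r^{pq}=K_p\cap dK_{p-r}\cap K^{p+q}$, and $d_r:E_r^{pq}\to E_r^{p+r,q+1-r}$, $[\mathfrak{z}]_{E_r^{pq}}\mapsto[d\mathfrak{z}]_{E_r^{p+r,q+1-r}}$. Here $[\cdot]_{E_r^{pq}}$ denotes the class in $E_r^{pq}$. Notation: a Latin letter with double superscript, $z^{rs}$, denotes an element of $K^{rs}$; German letters such as $\mathfrak{z}_r^{pq}$ (elements of $Z_r^{pq}$) do not refer to the bigrading. The notations ${}^r\!H(\cdot)$ and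 $[\cdot]_r$ denote the cohomology of the differential $\overline{d}_{2r}$ and the corresponding classes, defined recursively: ${}^0\!H^{pq}(K)$ is the degree-$q$ cohomology of $(K^{*p},\overline{d}_0=d')$, and ${}^{r}\!H({}^{r-1}\!H(\ldots({}^0\!H(K))))$ is the cohomology of ${}^{r-1}\!H(\ldots({}^0\!H(K)))$ for $\overline{d}_{2r}$; the upper index $pq$ of these spaces refers to classes of elements $z^{qp}\in K^{qp}$. System $S(z^{qp};k)$: given $z^{qp}\in K^{qp}$ and $k\ge1$, this is the system in the unknowns $z^{q-2j,p+2j}\in K^{q-2j,p+2j}$, $1\le j\le k-1$, consisting of the equations $$d'z^{qp}=0,\qquad d''z^{q-2(j-1),p+2(j-1)}+d'z^{q-2j,p+2j}=0\quad(1\le j\le k-1).$$ A solution is written as $(z^{qp},z^{q-2,p+2},\ldots,z^{q-2(k-1),p+2(k-1)})$. *)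

theory Defs
  imports Complex_Main "HOL-Library.Set_Algebras"
begin

text \<open>
  The quotient of a subspace \<open>Z\<close> by a subspace \<open>W\<close> is the set of cosets \<open>z +o W\<close> with
  \<open>z \<in> Z\<close>. Cosets are added by the set addition of \<^theory>\<open>HOL-Library.Set_Algebras\<close>. The scalar
  multiple of a coset has to be corrected by the direction \<open>{y - z | y z. y \<in> X \<and> z \<in> X} = W\<close>,
  because \<open>scl 0 ` X\<close> is \<open>{0}\<close> and not \<open>W\<close>.
\<close>

definition coset_scale :: "('a \<Rightarrow> 'v \<Rightarrow> 'v) \<Rightarrow> 'a \<Rightarrow> 'v set \<Rightarrow> 'v::ab_group_add set" where
  "coset_scale scl c X = {scl c x + (y - z) | x y z. x \<in> X \<and> y \<in> X \<and> z \<in> X}"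

lemma (in module) coset_add_coset:
  assumes "subspace W"
  shows "(x +o W) + (y +o W) = (x + y) +o W"
proof -
  have "W + W = W"
    using assms subspace_add[of W] subspace_0[of W]
    by (auto simp: set_plus_def) (metis add_0)
  then show ?thesis
    by (simp add: set_plus_rearrange)
qed

lemma (in module) coset_scale_coset:
  assumes "subspace W"
  shows "coset_scale scale c (x +o W) = scale c x +o W"
proof (intro equalityI subsetI)
  fix u assume "u \<in> coset_scale scale c (x +o W)"
  then obtain a b e where abe: "a \<in> W" "b \<in> W" "e \<in> W"
    and u: "u = scale c (x + a) + ((x + b) - (x + e))"
    by (auto simp: coset_scale_def elt_set_plus_def)
  have "u = scale c x + (scale c a + (b - e))"
    by (simp add: u scale_right_distrib algebra_simps)
  moreover have "scale c a + (b - e) \<in> W"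
    using abe assms by (intro subspace_add subspace_diff subspace_scale)
  ultimately show "u \<in> scale c x +o W"
    by (auto simp: elt_set_plus_def)
next
  fix u assume "u \<in> scale c x +o W"
  then obtain w where w: "w \<in> W" "u = scale c x + w"
    by (auto simp: elt_set_plus_def)
  have "0 \<in> W" using assms by (rule subspace_0)
  then have "x \<in> x +o W" by (auto simp: elt_set_plus_def intro: bexI[of _ 0])
  moreover have "x + w \<in> x +o W" using w by (auto simp: elt_set_plus_def)
  moreover have "u = scale c x + ((x + w) - x)" using w by simp
  ultimately show "u \<in> coset_scale scale c (x +o W)"
    unfolding coset_scale_def by blast
qed

definition linear_bij ::
  "('a \<Rightarrow> 'x \<Rightarrow> 'x) \<Rightarrow> 'x::plus set \<Rightarrow> ('a \<Rightarrow> 'y \<Rightarrow> 'y) \<Rightarrow> 'y::plus set \<Rightarrow> ('x \<Rightarrow> 'y) \<Rightarrow> bool" where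
  "linear_bij scl V scl' V' f \<longleftrightarrow>
     bij_betw f V V' \<and>
     (\<forall>x\<in>V. \<forall>y\<in>V. f (x + y) = f x + f y) \<and>
     (\<forall>c. \<forall>x\<in>V. f (scl c x) = scl' c (f x))"

text \<open>
  The space \<open>K\<close> is the whole type \<open>'v\<close>; \<open>bideg D r s\<close> is the subspace \<open>K\<^sup>r\<^sup>s\<close>.
  All bidegrees are integers.
\<close>

record ('a, 'v) double_complex =
  scl :: "'a \<Rightarrow> 'v \<Rightarrow> 'v"
  bideg :: "int \<Rightarrow> int \<Rightarrow> 'v set"
  diff :: "'v \<Rightarrow> 'v"

definition decomposition ::
  "('a, 'v::ab_group_add) double_complex \<Rightarrow> 'v \<Rightarrow> (int \<times> int \<Rightarrow> 'v) \<Rightarrow> bool" where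
  "decomposition D x f \<longleftrightarrow>
     (\<forall>r s. f (r, s) \<in> bideg D r s) \<and> finite {rs. f rs \<noteq> 0} \<and> x = (\<Sum>rs | f rs \<noteq> 0. f rs)"

definition component ::
  "('a, 'v::ab_group_add) double_complex \<Rightarrow> int \<Rightarrow> int \<Rightarrow> 'v \<Rightarrow> 'v" where
  "component D r s x = (THE f. decomposition D x f) (r, s)"

definition total_deg ::
  "('a::field, 'v::ab_group_add) double_complex \<Rightarrow> int \<Rightarrow> 'v set" where
  "total_deg D n = module.span (scl D) (\<Union>{bideg D r s | r s. r + s = n})"

text \<open>The component \<open>d\<^sub>a\<^sub>b\<close> of bidegree \<open>(a, b)\<close> of the differential, as a map on all of \<open>K\<close>.\<close>

definition diff_comp ::
  "('a, 'v::ab_group_add) double_complex \<Rightarrow> int \<Rightarrow> int \<Rightarrow> 'v \<Rightarrow> 'v" where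
  "diff_comp D a b x =
     (\<Sum>(r, s) | component D r s x \<noteq> 0. component D (r + a) (s + b) (diff D (component D r s x)))"

locale vpdc = vector_space "scl D"
  for D :: "('a::field, 'v::ab_group_add) double_complex" +
  assumes subspace_bideg: "module.subspace (scl D) (bideg D r s)"
    and bideg_neg: "r < 0 \<or> s < 0 \<Longrightarrow> bideg D r s = {0}"
    and direct_sum: "\<exists>!f. decomposition D x f"
    and linear_diff: "Vector_Spaces.linear (scl D) (scl D) (diff D)"
    and diff_total: "diff D ` total_deg D n \<subseteq> total_deg D (n + 1)"
    and diff_diff: "diff D (diff D x) = 0"
    and vert_pos: "a + b = 1 \<Longrightarrow> b < 0 \<Longrightarrow> diff_comp D a b x = 0"

abbreviation d1 :: "('a, 'v::ab_group_add) double_complex \<Rightarrow> 'v \<Rightarrow> 'v" where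
  "d1 D \<equiv> diff_comp D 1 0"

abbreviation d2 :: "('a, 'v::ab_group_add) double_complex \<Rightarrow> 'v \<Rightarrow> 'v" where
  "d2 D \<equiv> diff_comp D (-1) 2"

definition hfilt ::
  "('a::field, 'v::ab_group_add) double_complex \<Rightarrow> int \<Rightarrow> 'v set" where
  "hfilt D p = module.span (scl D) (\<Union>{bideg D r s | r s. 0 \<le> r \<and> p \<le> s})"

text \<open>The index \<open>r\<close> is an integer because the page \<open>E\<^sub>0\<close> involves \<open>r = -1\<close>.\<close>

definition Zc ::
  "('a::field, 'v::ab_group_add) double_complex \<Rightarrow> int \<Rightarrow> int \<Rightarrow> int \<Rightarrow> 'v set" where
  "Zc D r p q = hfilt D p \<inter> diff D -` hfilt D (p + r) \<inter> total_deg D (p + q)"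

definition Bc ::
  "('a::field, 'v::ab_group_add) double_complex \<Rightarrow> int \<Rightarrow> int \<Rightarrow> int \<Rightarrow> 'v set" where
  "Bc D r p q = hfilt D p \<inter> diff D ` hfilt D (p - r) \<inter> total_deg D (p + q)"

definition page_class ::
  "('a::field, 'v::ab_group_add) double_complex \<Rightarrow> nat \<Rightarrow> int \<Rightarrow> int \<Rightarrow> 'v \<Rightarrow> 'v set" where
  "page_class D r p q z = z +o (Zc D (int r - 1) (p + 1) (q - 1) + Bc D (int r - 1) p q)"

definition page ::
  "('a::field, 'v::ab_group_add) double_complex \<Rightarrow> nat \<Rightarrow> int \<Rightarrow> int \<Rightarrow> 'v set set" where
  "page D r p q = page_class D r p q ` Zc D (int r) p q"

definition page_diff ::
  "('a::field, 'v::ab_group_add) double_complex \<Rightarrow> nat \<Rightarrow> int \<Rightarrow> int \<Rightarrow> 'v set \<Rightarrow> 'v set" where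
  "page_diff D r p q X =
     the_elem ((\<lambda>z. page_class D r (p + int r) (q + 1 - int r) (diff D z)) ` X)"

text \<open>
  \<open>class_map D c p q\<close> is the map on \<open>E\<^sub>s\<^sup>p\<^sup>q\<close> induced by \<open>z \<mapsto> c p q z\<^sup>q\<^sup>p\<close>; note the
  interchange of the indices. \<open>transport D c s\<close> is \<open>I \<circ> d\<^sub>s \<circ> I\<^sup>-\<^sup>1\<close> for the maps \<open>I\<close> of this form.
\<close>

definition class_map ::
  "('a::field, 'v::ab_group_add) double_complex \<Rightarrow> (int \<Rightarrow> int \<Rightarrow> 'v \<Rightarrow> 'w) \<Rightarrow>
    int \<Rightarrow> int \<Rightarrow> 'v set \<Rightarrow> 'w" where
  "class_map D c p q X = the_elem ((\<lambda>z. c p q (component D q p z)) ` X)"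

definition transport ::
  "('a::field, 'v::ab_group_add) double_complex \<Rightarrow> (int \<Rightarrow> int \<Rightarrow> 'v \<Rightarrow> 'w) \<Rightarrow>
    nat \<Rightarrow> int \<Rightarrow> int \<Rightarrow> 'w \<Rightarrow> 'w" where
  "transport D c s p q \<xi> =
     class_map D c (p + int s) (q + 1 - int s)
       (page_diff D s p q (inv_into (page D s p q) (class_map D c p q) \<xi>))"

text \<open>
  Elements of an iterated cohomology space are classes of classes of \<open>\<dots>\<close> of elements of \<open>K\<close>, so
  their type would depend on the number of iterations. A class of cosets is therefore replaced by
  its union, which is again a coset in \<open>K\<close>: \<open>merged_class R X\<close> is the union of the class
  \<open>{X + Y | Y. Y \<in> R}\<close> of \<open>X\<close> modulo \<open>R\<close>. Distinct classes have disjoint unions, and the vector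
  space operations on classes become addition of sets and \<^const>\<open>coset_scale\<close>.
\<close>

definition merged_class :: "'v::ab_group_add set set \<Rightarrow> 'v set \<Rightarrow> 'v set" where
  "merged_class R X = \<Union>{X + Y | Y. Y \<in> R}"

text \<open>
  \<open>iter_class D r p q z\<close> is the iterated class \<open>[\<dots>[[z]\<^sub>0]\<^sub>1\<dots>]\<^sub>r\<close> of \<open>z \<in> K\<^sup>q\<^sup>p\<close>, and
  \<open>iter_coh D r p q\<close> is the bidegree \<open>(p, q)\<close> part of the space \<open>\<^sup>rH(\<dots>(\<^sup>0H(K)))\<close>.
  The differential used in step \<open>Suc r\<close> is the transported one of the page \<open>E\<^sub>2\<^sub>r\<^sub>+\<^sub>2\<close>;
  it maps bidegree \<open>(p, q)\<close> to \<open>(p + (2r + 2), q + 1 - (2r + 2))\<close>. The zero vector of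
  \<open>iter_coh D r p q\<close> is \<open>iter_class D r p q 0\<close>. The set \<open>iter_class D r p q z\<close> is formed for
  every \<open>z\<close>; for \<open>z\<close> in \<open>K\<^sup>q\<^sup>p\<close> it belongs to \<open>iter_coh D r p q\<close> exactly if the successive classes
  of \<open>z\<close> are cocycles, that is, if the iterated class of \<open>z\<close> is defined.
\<close>

fun iter_class ::
    "('a::field, 'v::ab_group_add) double_complex \<Rightarrow> nat \<Rightarrow> (int \<Rightarrow> int \<Rightarrow> 'v \<Rightarrow> 'v set)"
  and iter_coh ::
    "('a::field, 'v::ab_group_add) double_complex \<Rightarrow> nat \<Rightarrow> (int \<Rightarrow> int \<Rightarrow> 'v set set)"
where
  "iter_class D 0 = (\<lambda>p q z. z +o (d1 D ` bideg D (q - 1) p))"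
| "iter_coh D 0 = (\<lambda>p q. iter_class D 0 p q ` {z \<in> bideg D q p. d1 D z = 0})"
| "iter_class D (Suc r) = (\<lambda>p q z.
     let s = 2 * Suc r; p' = p - int s; q' = q - 1 + int s in
     merged_class (transport D (iter_class D r) s p' q' ` iter_coh D r p' q') (iter_class D r p q z))"
| "iter_coh D (Suc r) = (\<lambda>p q.
     let s = 2 * Suc r; p' = p - int s; q' = q - 1 + int s in
     merged_class (transport D (iter_class D r) s p' q' ` iter_coh D r p' q') `
       {X \<in> iter_coh D r p q.
          transport D (iter_class D r) s p q X
            = iter_class D r (p + int s) (q + 1 - int s) 0})"

definition I0 ::
  "('a::field, 'v::ab_group_add) double_complex \<Rightarrow> int \<Rightarrow> int \<Rightarrow> 'v set \<Rightarrow> 'v" where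
  "I0 D = class_map D (\<lambda>p q z. z)"

definition dbar0 ::
  "('a::field, 'v::ab_group_add) double_complex \<Rightarrow> int \<Rightarrow> int \<Rightarrow> 'v \<Rightarrow> 'v" where
  "dbar0 D = transport D (\<lambda>p q z. z) 0"

text \<open>
  For \<open>s \<ge> 1\<close>; both \<open>s = 2r - 1\<close> and \<open>s = 2r\<close> give \<open>(s - 1) div 2 = r - 1\<close>.
\<close>

definition I_map ::
  "('a::field, 'v::ab_group_add) double_complex \<Rightarrow> nat \<Rightarrow> int \<Rightarrow> int \<Rightarrow> 'v set \<Rightarrow> 'v set" where
  "I_map D s = class_map D (iter_class D ((s - 1) div 2))"

definition dbar ::
  "('a::field, 'v::ab_group_add) double_complex \<Rightarrow> nat \<Rightarrow> int \<Rightarrow> int \<Rightarrow> 'v set \<Rightarrow> 'v set" where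
  "dbar D s = transport D (iter_class D ((s - 1) div 2)) s"

text \<open>\<open>zs\<close> is a solution of \<open>S(z\<^sup>q\<^sup>p; k)\<close>; only the entries \<open>zs 0, \<dots>, zs (k - 1)\<close> matter.\<close>

definition solves_S ::
  "('a, 'v::ab_group_add) double_complex \<Rightarrow> int \<Rightarrow> int \<Rightarrow> 'v \<Rightarrow> nat \<Rightarrow> (nat \<Rightarrow> 'v) \<Rightarrow> bool" where
  "solves_S D p q z k zs \<longleftrightarrow>
     zs 0 = z \<and>
     (\<forall>j<k. zs j \<in> bideg D (q - 2 * int j) (p + 2 * int j)) \<and>
     d1 D z = 0 \<and>
     (\<forall>j\<in>{1..k - 1}. d2 D (zs (j - 1)) + d1 D (zs j) = 0)"

end

theory Submission
  imports Defs
begin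

text \<open>
  Taking the component of bidegree \<open>(q, p)\<close> is injective on \<open>E\<^sub>s\<^sup>p\<^sup>q\<close>: a cocycle in \<open>Z\<^sub>s\<^sup>p\<^sup>q\<close> without
  this component lies in \<open>Z\<^sub>s\<^sub>-\<^sub>1\<^sup>p\<^sup>+\<^sup>1\<^sup>,\<^sup>q\<^sup>-\<^sup>1\<close>. So the page is the quotient \<open>M\<^sub>s / N\<^sub>s\<close> of the leading
  components of cocycles by those of boundaries, two subspaces of \<open>K\<^sup>q\<^sup>p\<close>. The usual argument for
  \<open>E\<^sub>s\<^sub>+\<^sub>1 = H(E\<^sub>s)\<close> shows that \<open>M\<^sub>s\<^sub>+\<^sub>1 / N\<^sub>s\<close> is the kernel and \<open>N\<^sub>s\<^sub>+\<^sub>1 / N\<^sub>s\<close> the image of the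
  transported differential. For odd \<open>s\<close> a parity argument gives \<open>M\<^sub>s\<^sub>+\<^sub>1 = M\<^sub>s\<close> and \<open>N\<^sub>s\<^sub>+\<^sub>1 = N\<^sub>s\<close>, so
  an iterated cohomology class of \<open>z\<close> is the coset of \<open>z\<close> modulo \<open>N\<^sub>2\<^sub>r\<^sub>+\<^sub>1\<close>. The entries of a solution
  of \<open>S(z; r)\<close> add up to a cocycle in \<open>Z\<^sub>2\<^sub>r\<close> with leading component \<open>z\<close>; conversely, the components of
  a cocycle in \<open>Z\<^sub>2\<^sub>r\<^sub>-\<^sub>1\<close> in every second filtration degree form a solution.
\<close>

section \<open>Components with respect to the bigrading, and the filtration in terms of them\<close>

context vpdc
begin

lemma decompositionI:
  assumes "\<And>r s. f (r, s) \<in> bideg D r s" "finite A" "\<And>rs. rs \<notin> A \<Longrightarrow> f rs = 0" "x = sum f A"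
  shows "decomposition D x f"
proof -
  have sub: "{rs. f rs \<noteq> 0} \<subseteq> A" using assms(3) by blast
  have "sum f {rs. f rs \<noteq> 0} = sum f A"
    by (rule sum.mono_neutral_left) (use assms sub in auto)
  then show ?thesis
    unfolding decomposition_def using assms sub finite_subset by metis
qed

lemma component_unique: "decomposition D x f \<Longrightarrow> component D r s x = f (r, s)"
  unfolding component_def using direct_sum[of x] by (metis the1_equality)

lemma decomposition_component: "decomposition D x (\<lambda>(r, s). component D r s x)"
proof -
  obtain f where f: "decomposition D x f" using direct_sum by blast
  then have "f = (\<lambda>(r, s). component D r s x)"
    by (auto simp: component_unique)
  with f show ?thesis by simp
qed

lemma component_mem: "component D r s x \<in> bideg D r s"
  using decomposition_component[of x] by (auto simp: decomposition_def)

lemma finite_support: "finite {(r, s). component D r s x \<noteq> 0}"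
  using decomposition_component[of x] by (simp add: decomposition_def case_prod_unfold)

lemma sum_components:
  assumes "finite A" "{(r, s). component D r s x \<noteq> 0} \<subseteq> A"
  shows "(\<Sum>(r, s)\<in>A. component D r s x) = x"
proof -
  have "(\<Sum>(r, s)\<in>A. component D r s x) =
      (\<Sum>(r, s) | component D r s x \<noteq> 0. component D r s x)"
    using assms by (intro sum.mono_neutral_right) auto
  also have "\<dots> = x"
    using decomposition_component[of x] by (simp add: decomposition_def case_prod_unfold)
  finally show ?thesis .
qed

lemma component_eqI:
  assumes "\<And>r s. component D r s x = component D r s y"
  shows "x = y"
proof -
  have "x = (\<Sum>(r, s) | component D r s x \<noteq> 0. component D r s x)"
    by (rule sum_components[symmetric]) (use finite_support in auto)
  also have "\<dots> = (\<Sum>(r, s) | component D r s y \<noteq> 0. component D r s y)"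
    by (simp only: assms)
  also have "\<dots> = y"
    by (rule sum_components) (use finite_support in auto)
  finally show ?thesis .
qed

lemma zero_mem_bideg: "0 \<in> bideg D r s"
  by (rule subspace_0[OF subspace_bideg])

lemma component_bideg:
  assumes "x \<in> bideg D r s"
  shows "component D r' s' x = (if r' = r \<and> s' = s then x else 0)"
proof -
  have "decomposition D x (\<lambda>rs. if rs = (r, s) then x else 0)"
    by (rule decompositionI[where A = "{(r, s)}"]) (use assms zero_mem_bideg in auto)
  then show ?thesis by (simp add: component_unique)
qed

lemma module_hom_component: "module_hom (scl D) (scl D) (component D r s)"
proof -
  have add: "component D r s (x + y) = component D r s x + component D r s y" for r s x y
  proof -
    let ?A = "{(r, s). component D r s x \<noteq> 0} \<union> {(r, s). component D r s y \<noteq> 0}"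
    have "decomposition D (x + y) (\<lambda>(r, s). component D r s x + component D r s y)"
    proof (rule decompositionI[where A = ?A])
      have "(\<Sum>(r, s)\<in>?A. component D r s x) = x" "(\<Sum>(r, s)\<in>?A. component D r s y) = y"
        by (intro sum_components; use finite_support in auto)+
      then show "x + y = sum (\<lambda>(r, s). component D r s x + component D r s y) ?A"
        by (simp add: case_prod_unfold sum.distrib)
    qed (use finite_support component_mem subspace_add[OF subspace_bideg] in auto)
    then show ?thesis by (simp add: component_unique)
  qed
  have scale: "component D r s (scl D c x) = scl D c (component D r s x)" for r s c x
  proof -
    let ?A = "{(r, s). component D r s x \<noteq> 0}"
    have "decomposition D (scl D c x) (\<lambda>(r, s). scl D c (component D r s x))"
    proof (rule decompositionI[where A = ?A])
      have "(\<Sum>(r, s)\<in>?A. component D r s x) = x"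
        by (rule sum_components) (use finite_support in auto)
      then show "scl D c x = sum (\<lambda>(r, s). scl D c (component D r s x)) ?A"
        by (simp add: case_prod_unfold flip: scale_sum_right)
    qed (use finite_support component_mem subspace_scale[OF subspace_bideg] in auto)
    then show ?thesis by (simp add: component_unique)
  qed
  show ?thesis
    by unfold_locales (auto simp: add scale)
qed

lemmas component_add = module_hom.add[OF module_hom_component]
  and component_scale = module_hom.scale[OF module_hom_component]
  and component_zero [simp] = module_hom.zero[OF module_hom_component]
  and component_diff = module_hom.diff[OF module_hom_component]
  and component_sum = module_hom.sum[OF module_hom_component]

lemma module_hom_diff: "module_hom (scl D) (scl D) (diff D)"
  using linear_diff by (simp add: module_hom_iff_linear)

lemmas diff_add = module_hom.add[OF module_hom_diff]
  and diff_zero [simp] = module_hom.zero[OF module_hom_diff]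
  and diff_minus = module_hom.diff[OF module_hom_diff]

lemma component_neg_degree: "r < 0 \<or> s < 0 \<Longrightarrow> component D r s x = 0"
  using component_mem[of r s x] bideg_neg[of r s] by auto

text \<open>Allows an element to be cut down to its part of one total degree or of one parity of the
  second degree. An existence statement is enough because elements are determined by their
  components.\<close>

lemma partial_sum:
  "\<exists>w. \<forall>r s. component D r s w = (if P r s then component D r s x else 0)"
proof (intro exI allI)
  fix r s
  let ?S = "{(r, s). component D r s x \<noteq> 0 \<and> P r s}"
  have fin: "finite ?S"
    by (rule finite_subset[OF _ finite_support[of x]]) auto
  have "component D r s (\<Sum>(r, s)\<in>?S. component D r s x) =
      (\<Sum>rs\<in>?S. if rs = (r, s) then component D r s x else 0)"
    unfolding component_sum
    by (rule sum.cong) (auto simp: component_bideg[OF component_mem] split: if_splits)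
  also have "\<dots> = (if P r s then component D r s x else 0)"
    using fin by (auto simp: sum.delta)
  finally show "component D r s (\<Sum>(r, s)\<in>?S. component D r s x) =
      (if P r s then component D r s x else 0)" .
qed

text \<open>Replaces the spans in \<open>total_deg\<close> and \<open>hfilt\<close> by vanishing
  conditions on components, which turns later membership proofs into arithmetic on
  bidegrees.\<close>

lemma span_bideg_eq:
  "span (\<Union>{bideg D r s | r s. P r s}) = {x. \<forall>r s. \<not> P r s \<longrightarrow> component D r s x = 0}"
    (is "?L = ?R")
proof (intro equalityI subsetI)
  have "subspace ?R"
    by (auto simp: subspace_def component_add component_scale)
  moreover have "\<Union>{bideg D r s | r s. P r s} \<subseteq> ?R"
    by (auto simp: component_bideg)
  ultimately have "?L \<subseteq> ?R" by (rule span_minimal[rotated])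
  then show "x \<in> ?R" if "x \<in> ?L" for x
    using that by (rule subsetD)
next
  fix x assume x: "x \<in> ?R"
  have "(\<Sum>(r, s) | component D r s x \<noteq> 0. component D r s x) \<in> ?L"
    using x by (intro span_sum) (force intro!: span_base component_mem)
  then show "x \<in> ?L" using sum_components[OF finite_support order_refl, of x] by simp
qed

lemma total_deg_eq: "total_deg D n = {x. \<forall>r s. r + s \<noteq> n \<longrightarrow> component D r s x = 0}"
  unfolding total_deg_def span_bideg_eq by simp

text \<open>The condition \<open>0 \<le> r\<close> disappears because components of negative first
  degree vanish anyway.\<close>

lemma hfilt_eq: "hfilt D p = {x. \<forall>r s. s < p \<longrightarrow> component D r s x = 0}"
  unfolding hfilt_def span_bideg_eq using component_neg_degree by (force simp: not_le)

text \<open>Of the sum defining \<open>diff_comp\<close>, only the summand starting in bidegree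
  \<open>(r - a, s - b)\<close> reaches \<open>(r, s)\<close>.\<close>

lemma component_diff_comp:
  "component D r s (diff_comp D a b x) = component D r s (diff D (component D (r - a) (s - b) x))"
proof -
  let ?S = "{(r, s). component D r s x \<noteq> 0}"
  have "component D r s (diff_comp D a b x) =
      (\<Sum>(r', s')\<in>?S. component D r s
        (component D (r' + a) (s' + b) (diff D (component D r' s' x))))"
    unfolding diff_comp_def component_sum by (simp add: case_prod_unfold)
  also have "\<dots> = (\<Sum>rs\<in>?S. if rs = (r - a, s - b)
      then component D r s (diff D (component D (r - a) (s - b) x)) else 0)"
    by (rule sum.cong) (auto simp: component_bideg[OF component_mem] split: if_splits)
  also have "\<dots> = component D r s (diff D (component D (r - a) (s - b) x))"
    using finite_support[of x] by (auto simp: sum.delta)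
  finally show ?thesis .
qed

lemma diff_comp_bideg:
  assumes "x \<in> bideg D r s"
  shows "diff_comp D a b x = component D (r + a) (s + b) (diff D x)"
proof (rule component_eqI)
  fix r' s'
  have *: "r' - a = r \<longleftrightarrow> r' = r + a" "s' - b = s \<longleftrightarrow> s' = s + b" by auto
  show "component D r' s' (diff_comp D a b x) =
      component D r' s' (component D (r + a) (s + b) (diff D x))"
    unfolding component_diff_comp component_bideg[OF assms] component_bideg[OF component_mem] *
    by simp
qed

lemma diff_comp_mem:
  assumes "x \<in> bideg D r s"
  shows "diff_comp D a b x \<in> bideg D (r + a) (s + b)"
  by (simp add: diff_comp_bideg[OF assms] component_mem)

end

section \<open>Cocycles, boundaries and their leading components\<close>

locale two_term_vpdc = vpdc +
  assumes diff_split: "diff D x = d1 D x + d2 D x"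
begin

text \<open>Bidegree \<open>(r, s)\<close> can be entered only by \<open>d1\<close> from the left
  neighbour and by \<open>d2\<close> from two filtration levels below. All computations with
  \<open>diff\<close> go through this formula.\<close>

lemma component_diff_eq:
  "component D r s (diff D x) =
    d1 D (component D (r - 1) s x) + d2 D (component D (r + 1) (s - 2) x)"
proof -
  have "component D r s (diff D x) = component D r s (d1 D x) + component D r s (d2 D x)"
    by (simp add: diff_split component_add)
  then show ?thesis
    unfolding component_diff_comp
    using diff_comp_bideg[OF component_mem, of 1 0 "r - 1" s x]
      diff_comp_bideg[OF component_mem, of "-1" 2 "r + 1" "s - 2" x] by simp
qed

lemma diff_comp_zero [simp]: "diff_comp D a b 0 = 0"
  by (simp add: diff_comp_def)

lemma mem_Zc:
  "z \<in> Zc D s p q \<longleftrightarrow>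
    (\<forall>a b. component D a b z \<noteq> 0 \<longrightarrow> p \<le> b \<and> a + b = p + q) \<and>
    (\<forall>a b. b < p + s \<longrightarrow> component D a b (diff D z) = 0)"
  unfolding Zc_def hfilt_eq total_deg_eq by (auto simp: not_less[symmetric])

lemma subspace_Zc: "subspace (Zc D s p q)"
  by (auto simp: subspace_def mem_Zc component_add component_scale diff_add
      module_hom.scale[OF module_hom_diff] component_diff)
    (metis add.right_neutral)+

text \<open>Only the part of \<open>y\<close> of total degree \<open>p + q - 1\<close> contributes to a boundary \<open>d y\<close> of
  degree \<open>p + q\<close>.\<close>

lemma Bc_eq: "Bc D s p q = diff D ` Zc D s (p - s) (q + s - 1)"
proof (intro equalityI subsetI)
  fix b assume "b \<in> Bc D s p q"
  then obtain y where b: "b = diff D y"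
    and bp: "\<And>a c. c < p \<Longrightarrow> component D a c b = 0"
    and bt: "\<And>a c. a + c \<noteq> p + q \<Longrightarrow> component D a c b = 0"
    and y: "\<And>a c. c < p - s \<Longrightarrow> component D a c y = 0"
    unfolding Bc_def hfilt_eq total_deg_eq by auto
  obtain w where w: "\<And>a c. component D a c w = (if a + c = p + q - 1 then component D a c y else 0)"
    using partial_sum[of "\<lambda>a c. a + c = p + q - 1" y] by blast
  have dw: "diff D w = b"
  proof (rule component_eqI)
    fix a c show "component D a c (diff D w) = component D a c b"
    proof (cases "a + c = p + q")
      case True
      then show ?thesis unfolding b component_diff_eq by (simp add: w)
    next
      case False
      then show ?thesis using bt[OF False] by (simp add: component_diff_eq w)
    qed
  qed
  have "w \<in> Zc D s (p - s) (q + s - 1)"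
    unfolding mem_Zc dw using bp y by (auto simp: w not_le[symmetric] split: if_splits)
  with dw show "b \<in> diff D ` Zc D s (p - s) (q + s - 1)" by blast
next
  fix b assume "b \<in> diff D ` Zc D s (p - s) (q + s - 1)"
  then obtain y where b: "b = diff D y" and y: "y \<in> Zc D s (p - s) (q + s - 1)" by blast
  have "component D a c b = 0" if "a + c \<noteq> p + q" for a c
  proof -
    have "component D (a - 1) c y = 0" "component D (a + 1) (c - 2) y = 0"
      using y that unfolding mem_Zc by fastforce+
    then show ?thesis by (simp add: b component_diff_eq)
  qed
  moreover have "y \<in> hfilt D (p - s)" using y by (auto simp: Zc_def)
  ultimately show "b \<in> Bc D s p q"
    using y by (auto simp: b Bc_def Zc_def total_deg_eq)
qed

text \<open>As \<open>diff\<close> squares to zero, a boundary is a cocycle of every level, hence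
  the free \<open>t\<close>.\<close>

lemma diff_mem_Zc: "z \<in> Zc D s p q \<Longrightarrow> diff D z \<in> Zc D t (p + s) (q + 1 - s)"
  using Bc_eq[of s "p + s" "q + 1 - s"]
  by (auto simp: Bc_def Zc_def diff_diff hfilt_eq add.commute)

lemma Bc_subset_Zc: "Bc D s p q \<subseteq> Zc D t p q"
  using diff_mem_Zc[of _ s "p - s" "q + s - 1" t] by (auto simp: Bc_eq)

lemma Zc_antimono: "s \<le> t \<Longrightarrow> Zc D t p q \<subseteq> Zc D s p q"
  by (auto simp: mem_Zc)

text \<open>Both sides ask that the differential lie in filtration \<open>p + s + 1\<close> and have
  total degree \<open>p + q\<close>; only the filtration bound on the element itself is
  relaxed.\<close>

lemma Zc_shift: "Zc D s (p + 1) (q - 1) \<subseteq> Zc D (s + 1) p q"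
  by (fastforce simp: mem_Zc add.commute add.left_commute)

lemma subspace_Bc: "subspace (Bc D s p q)"
  unfolding Bc_eq by (rule module_hom.subspace_image[OF module_hom_diff subspace_Zc])

text \<open>This is \<open>M\<^sub>s\<close> of the overview. The level is an integer, as in
  \<open>Zc\<close>, so that shifts such as \<open>s - 1\<close> make sense at
  \<open>s = 0\<close>.\<close>

definition cocycle_lead :: "int \<Rightarrow> int \<Rightarrow> int \<Rightarrow> 'b set" where
  "cocycle_lead s p q = component D q p ` Zc D s p q"

text \<open>This is \<open>N\<^sub>s\<close>. The level \<open>s - 1\<close> of the boundaries is
  the one in the denominator of page \<open>s\<close>, so that \<open>M\<^sub>s\<close> and
  \<open>N\<^sub>s\<close> belong to the same page.\<close>

definition boundary_lead :: "int \<Rightarrow> int \<Rightarrow> int \<Rightarrow> 'b set" where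
  "boundary_lead s p q = component D q p ` Bc D (s - 1) p q"

definition page_denom :: "int \<Rightarrow> int \<Rightarrow> int \<Rightarrow> 'b set" where
  "page_denom s p q = Zc D (s - 1) (p + 1) (q - 1) + Bc D (s - 1) p q"

lemma boundary_lead_eq:
  "boundary_lead s p q = (\<lambda>y. component D q p (diff D y)) ` Zc D (s - 1) (p - s + 1) (q + s - 2)"
  by (simp add: boundary_lead_def Bc_eq image_image algebra_simps)

lemma subspace_cocycle_lead: "subspace (cocycle_lead s p q)"
  unfolding cocycle_lead_def
  by (rule module_hom.subspace_image[OF module_hom_component subspace_Zc])

lemma subspace_boundary_lead: "subspace (boundary_lead s p q)"
  unfolding boundary_lead_def
  by (rule module_hom.subspace_image[OF module_hom_component subspace_Bc])

lemma cocycle_lead_subset: "cocycle_lead s p q \<subseteq> bideg D q p"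
  by (auto simp: cocycle_lead_def component_mem)

lemma boundary_lead_subset: "boundary_lead s p q \<subseteq> cocycle_lead t p q"
  unfolding boundary_lead_def cocycle_lead_def by (rule image_mono[OF Bc_subset_Zc])

lemma Zc_component_eq_0:
  "z \<in> Zc D s p q \<Longrightarrow> b < p \<or> a + b \<noteq> p + q \<Longrightarrow> component D a b z = 0"
  by (force simp: mem_Zc)

lemma Zc_diff_component_eq_0:
  "z \<in> Zc D s p q \<Longrightarrow> b < p + s \<Longrightarrow> component D a b (diff D z) = 0"
  by (auto simp: mem_Zc)

lemma component_diff_parity:
  assumes "\<And>a b. component D a b w = (if even (b - m) then component D a b y else 0)"
  shows "component D a b (diff D w) = (if even (b - m) then component D a b (diff D y) else 0)"
  unfolding component_diff_eq by (simp add: assms)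

text \<open>The differential changes the second degree by \<open>0\<close> or \<open>2\<close>, so cocycles and boundaries may be
  replaced by their parts of one parity; this is why nothing happens between an odd page and the
  next one.\<close>

lemma cocycle_lead_odd:
  assumes "odd s"
  shows "cocycle_lead (s + 1) p q = cocycle_lead s p q"
proof
  show "cocycle_lead (s + 1) p q \<subseteq> cocycle_lead s p q"
    using Zc_antimono[of s "s + 1"] by (auto simp: cocycle_lead_def)
  show "cocycle_lead s p q \<subseteq> cocycle_lead (s + 1) p q"
  proof
    fix x assume "x \<in> cocycle_lead s p q"
    then obtain z where z: "z \<in> Zc D s p q" and x: "x = component D q p z"
      by (auto simp: cocycle_lead_def)
    obtain w where w: "\<And>a b. component D a b w = (if even (b - p) then component D a b z else 0)"
      using partial_sum[of "\<lambda>a b. even (b - p)" z] by blast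
    \<comment> \<open>The only new condition compared with level \<open>s\<close> is at
      \<open>b = p + s\<close>, which has the wrong parity since \<open>s\<close> is odd.\<close>
    have "component D a b (diff D w) = 0" if "b < p + (s + 1)" for a b
    proof (cases "b = p + s")
      case True
      then show ?thesis using assms by (simp add: component_diff_parity[OF w])
    next
      case False
      then show ?thesis
        using that Zc_diff_component_eq_0[OF z, of b] by (simp add: component_diff_parity[OF w])
    qed
    then have "w \<in> Zc D (s + 1) p q"
      using z unfolding mem_Zc by (auto simp: w)
    moreover have "component D q p w = x"
      by (simp add: w x)
    ultimately show "x \<in> cocycle_lead (s + 1) p q"
      by (auto simp: cocycle_lead_def)
  qed
qed

text \<open>By \<open>Zc_shift\<close>, the cochains whose differentials give the left side are
  among those for the right side, which may start one filtration level lower.\<close>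

lemma boundary_lead_mono: "boundary_lead s p q \<subseteq> boundary_lead (s + 1) p q"
proof -
  have "Zc D (s - 1) (p - s + 1) (q + s - 2) \<subseteq> Zc D s (p - s) (q + s - 1)"
    using Zc_shift[of "s - 1" "p - s" "q + s - 1"] by (simp add: algebra_simps)
  then show ?thesis
    by (auto simp: boundary_lead_eq algebra_simps)
qed

lemma boundary_lead_odd:
  assumes "odd s"
  shows "boundary_lead (s + 1) p q = boundary_lead s p q"
proof
  show "boundary_lead s p q \<subseteq> boundary_lead (s + 1) p q"
    by (rule boundary_lead_mono)
  show "boundary_lead (s + 1) p q \<subseteq> boundary_lead s p q"
  proof
    fix x assume "x \<in> boundary_lead (s + 1) p q"
    then obtain y where y: "y \<in> Zc D s (p - s) (q + s - 1)" and x: "x = component D q p (diff D y)"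
      by (auto simp: boundary_lead_eq algebra_simps)
    obtain w where w: "\<And>a b. component D a b w = (if even (b - p) then component D a b y else 0)"
      using partial_sum[of "\<lambda>a b. even (b - p)" y] by blast
    \<comment> \<open>The lowest level \<open>p - s\<close> is excluded by parity, so
      \<open>w\<close> starts one level higher than \<open>y\<close>; this gain lowers the level of
      the boundary from \<open>s\<close> to \<open>s - 1\<close>.\<close>
    have "p - s + 1 \<le> b \<and> a + b = p + q - 1" if "component D a b w \<noteq> 0" for a b
    proof -
      have "even (b - p)" "p - s \<le> b" "a + b = p + q - 1"
        using that y by (auto simp: w mem_Zc split: if_splits)
      moreover have "b \<noteq> p - s"
        using \<open>even (b - p)\<close> assms by auto
      ultimately show ?thesis by auto
    qed
    moreover have "component D a b (diff D w) = 0" if "b < p" for a b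
      using that y by (simp add: component_diff_parity[OF w] mem_Zc)
    ultimately have "w \<in> Zc D (s - 1) (p - s + 1) (q + s - 2)"
      unfolding mem_Zc by force
    moreover have "component D q p (diff D w) = x"
      by (simp add: component_diff_parity[OF w] x)
    ultimately show "x \<in> boundary_lead s p q"
      by (auto simp: boundary_lead_eq)
  qed
qed

lemma subspace_page_denom: "subspace (page_denom s p q)"
proof -
  have "page_denom s p q =
      {x + y | x y. x \<in> Zc D (s - 1) (p + 1) (q - 1) \<and> y \<in> Bc D (s - 1) p q}"
    by (auto simp: page_denom_def set_plus_def)
  then show ?thesis by (simp add: subspace_sums subspace_Zc subspace_Bc)
qed

lemma component_page_denom:
  assumes "w \<in> page_denom s p q"
  shows "component D q p w \<in> boundary_lead s p q"
proof -
  obtain u b where "w = u + b" "u \<in> Zc D (s - 1) (p + 1) (q - 1)" "b \<in> Bc D (s - 1) p q"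
    using assms by (auto simp: page_denom_def set_plus_def)
  then show ?thesis
    using Zc_component_eq_0[of u "s - 1" "p + 1" "q - 1" p q]
    by (auto simp: component_add boundary_lead_def)
qed

text \<open>This is the injectivity of the leading component on a page. Subtracting a boundary with
  the same leading component leaves a cocycle that starts in filtration
  \<open>p + 1\<close>.\<close>

lemma mem_page_denom_iff:
  assumes z: "z \<in> Zc D s p q"
  shows "z \<in> page_denom s p q \<longleftrightarrow> component D q p z \<in> boundary_lead s p q"
proof
  assume "component D q p z \<in> boundary_lead s p q"
  then obtain b where b: "b \<in> Bc D (s - 1) p q" and eq: "component D q p z = component D q p b"
    by (auto simp: boundary_lead_def)
  have zb: "z - b \<in> Zc D s p q"
    using z b Bc_subset_Zc by (blast intro: subspace_diff[OF subspace_Zc])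
  have zero: "component D q p (z - b) = 0"
    by (simp add: component_diff eq)
  \<comment> \<open>In total degree \<open>p + q\<close> the only bidegree with second index
    \<open>p\<close> is \<open>(q, p)\<close>, where \<open>z - b\<close> vanishes.\<close>
  have "p + 1 \<le> c \<and> a + c = p + q" if ne: "component D a c (z - b) \<noteq> 0" for a c
  proof -
    have "p \<le> c" "a + c = p + q" using zb ne by (auto simp: mem_Zc)
    moreover have "c \<noteq> p"
      using calculation zero ne by (metis add.commute add_left_cancel)
    ultimately show ?thesis by auto
  qed
  then have "z - b \<in> Zc D (s - 1) (p + 1) (q - 1)"
    using zb unfolding mem_Zc by (auto simp: algebra_simps)
  then have "(z - b) + b \<in> page_denom s p q"
    using b unfolding page_denom_def by (rule set_plus_intro)
  then show "z \<in> page_denom s p q" by simp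
qed (rule component_page_denom)

text \<open>Makes \<open>page_diff\<close> well defined: the boundary summand is killed by
  \<open>diff\<close>, and the other summand is sent to boundaries in the denominator of the target
  page.\<close>

lemma diff_page_denom:
  assumes "w \<in> page_denom s p q"
  shows "diff D w \<in> page_denom s (p + s) (q + 1 - s)"
proof -
  obtain u b where w: "w = u + b" "u \<in> Zc D (s - 1) (p + 1) (q - 1)" "b \<in> Bc D (s - 1) p q"
    using assms by (auto simp: page_denom_def set_plus_def)
  then have "diff D w = 0 + diff D u"
    by (auto simp: Bc_def diff_add diff_diff)
  moreover have "diff D u \<in> Bc D (s - 1) (p + s) (q + 1 - s)"
    using w by (auto simp: Bc_eq algebra_simps)
  ultimately show ?thesis
    unfolding page_denom_def using subspace_0[OF subspace_Zc] by (metis set_plus_intro)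
qed

section \<open>Classes on a page, the page differential, and models of a page\<close>

lemma coset_eq_iff:
  assumes "subspace W"
  shows "x +o W = y +o W \<longleftrightarrow> x - y \<in> W"
proof
  assume "x +o W = y +o W"
  moreover have "x \<in> x +o W"
    using subspace_0[OF assms] by (auto simp: elt_set_plus_def)
  ultimately show "x - y \<in> W" by (auto simp: elt_set_plus_def)
next
  assume xy: "x - y \<in> W"
  have "x + w \<in> y +o W" "y + w \<in> x +o W" if "w \<in> W" for w
    using subspace_add[OF assms xy that] subspace_diff[OF assms that xy]
    by (auto simp: elt_set_plus_def intro: bexI[of _ "(x - y) + w"] bexI[of _ "w - (x - y)"])
  then show "x +o W = y +o W"
    by (auto simp: elt_set_plus_def)
qed

lemma page_class_eq: "page_class D s p q z = z +o page_denom (int s) p q"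
  by (simp add: page_class_def page_denom_def)

lemma page_class_nonempty: "page_class D s p q z \<noteq> {}"
  using subspace_0[OF subspace_page_denom] by (force simp: page_class_eq elt_set_plus_def)

lemma mem_page_classE:
  assumes "x \<in> page_class D s p q z"
  obtains w where "w \<in> page_denom (int s) p q" "x = z + w"
  using assms by (auto simp: page_class_eq elt_set_plus_def)

lemma page_class_eq_iff:
  assumes "z \<in> Zc D (int s) p q" "z' \<in> Zc D (int s) p q"
  shows "page_class D s p q z = page_class D s p q z' \<longleftrightarrow>
    component D q p z - component D q p z' \<in> boundary_lead (int s) p q"
  unfolding page_class_eq coset_eq_iff[OF subspace_page_denom]
  using mem_page_denom_iff[OF subspace_diff[OF subspace_Zc assms]] by (simp add: component_diff)

lemma page_diff_page_class:
  "page_diff D s p q (page_class D s p q z) =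
    page_class D s (p + int s) (q + 1 - int s) (diff D z)"
proof -
  have "page_class D s (p + int s) (q + 1 - int s) (diff D x) =
      page_class D s (p + int s) (q + 1 - int s) (diff D z)"
    if "x \<in> page_class D s p q z" for x
    using that
    by (rule mem_page_classE)
      (simp add: page_class_eq coset_eq_iff subspace_page_denom diff_page_denom flip: diff_minus)
  then show ?thesis
    unfolding page_diff_def by (rule the_elem_image_unique[OF page_class_nonempty])
qed

end

text \<open>Here \<open>c\<close> stands for the identity on page 0 and for an iterated class on
  later pages. That \<open>c\<close> identifies elements exactly modulo \<open>N\<^sub>s\<close> is
  all that is required to make the induced map on the page well defined and injective.\<close>

locale page_model = two_term_vpdc +
  fixes s :: nat and c :: "int \<Rightarrow> int \<Rightarrow> 'b \<Rightarrow> 'w::plus"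
  assumes c_eq_iff: "c p q x = c p q y \<longleftrightarrow> x - y \<in> boundary_lead (int s) p q"
begin

lemma class_map_page_class:
  "class_map D c p q (page_class D s p q z) = c p q (component D q p z)"
proof -
  have "c p q (component D q p x) = c p q (component D q p z)"
    if "x \<in> page_class D s p q z" for x
    using that
    by (rule mem_page_classE) (simp add: c_eq_iff component_page_denom component_add)
  then show ?thesis
    unfolding class_map_def by (rule the_elem_image_unique[OF page_class_nonempty])
qed

lemma inj_on_class_map: "inj_on (class_map D c p q) (page D s p q)"
  unfolding page_def
  by (auto simp: inj_on_def class_map_page_class page_class_eq_iff c_eq_iff)

lemma class_map_image: "class_map D c p q ` page D s p q = c p q ` cocycle_lead (int s) p q"
  by (simp add: page_def cocycle_lead_def image_image class_map_page_class)

lemma inv_class_map: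
  assumes "z \<in> Zc D (int s) p q"
  shows "inv_into (page D s p q) (class_map D c p q) (c p q (component D q p z)) =
    page_class D s p q z"
  using inv_into_f_f[OF inj_on_class_map[of p q], of "page_class D s p q z"] assms
  by (simp add: class_map_page_class page_def)

text \<open>The inverse of the model map returns the class of any cocycle with the given leading
  component, so the transported differential can be computed with whichever representative
  \<open>z\<close> is convenient.\<close>

lemma transport_eq:
  assumes "z \<in> Zc D (int s) p q"
  shows "transport D c s p q (c p q (component D q p z)) =
    c (p + int s) (q + 1 - int s) (component D (q + 1 - int s) (p + int s) (diff D z))"
  by (simp add: transport_def inv_class_map[OF assms] page_diff_page_class class_map_page_class)

lemma linear_bij_class_map:
  assumes "\<And>x y. c p q (x + y) = c p q x + c p q y"
    and "\<And>k x. c p q (scl D k x) = scl' k (c p q x)"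
  shows "linear_bij (coset_scale (scl D)) (page D s p q) scl' (c p q ` cocycle_lead (int s) p q)
    (class_map D c p q)"
  unfolding linear_bij_def
proof (intro conjI ballI allI)
  show "bij_betw (class_map D c p q) (page D s p q) (c p q ` cocycle_lead (int s) p q)"
    by (simp add: bij_betw_def inj_on_class_map class_map_image)
  show "class_map D c p q (X + Y) = class_map D c p q X + class_map D c p q Y"
    if XY: "X \<in> page D s p q" "Y \<in> page D s p q" for X Y
  proof -
    obtain x y where "X = page_class D s p q x" "Y = page_class D s p q y"
      using XY by (auto simp: page_def)
    moreover have "page_class D s p q x + page_class D s p q y = page_class D s p q (x + y)"
      by (simp add: page_class_eq coset_add_coset subspace_page_denom)
    ultimately show ?thesis
      by (simp add: class_map_page_class component_add assms)
  qed
  show "class_map D c p q (coset_scale (scl D) k X) = scl' k (class_map D c p q X)"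
    if X: "X \<in> page D s p q" for k X
  proof -
    obtain x where "X = page_class D s p q x"
      using X by (auto simp: page_def)
    moreover have "coset_scale (scl D) k (page_class D s p q x) = page_class D s p q (scl D k x)"
      by (simp add: page_class_eq coset_scale_coset subspace_page_denom)
    ultimately show ?thesis
      by (simp add: class_map_page_class component_scale assms)
  qed
qed

end

section \<open>The first pages, kernels of the page differentials, and the system
  \<open>S\<close>\<close>

context two_term_vpdc
begin

lemma bideg_subset_Zc: "bideg D q p \<subseteq> Zc D 0 p q"
  by (auto simp: mem_Zc component_bideg component_diff_eq split: if_splits)

lemma cocycle_lead_0: "cocycle_lead 0 p q = bideg D q p"
proof
  show "bideg D q p \<subseteq> cocycle_lead 0 p q"
    using bideg_subset_Zc by (force simp: cocycle_lead_def image_iff component_bideg)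
qed (rule cocycle_lead_subset)

text \<open>A contributing cochain starts in filtration \<open>p + 1\<close>, whereas bidegree
  \<open>(q, p)\<close> receives only from filtrations \<open>p\<close> and
  \<open>p - 2\<close>.\<close>

lemma boundary_lead_0: "boundary_lead 0 p q = {0}"
proof -
  have "component D q p (diff D y) = 0" if "y \<in> Zc D (- 1) (p + 1) (q - 2)" for y
    using that by (simp add: component_diff_eq Zc_component_eq_0)
  then have "boundary_lead 0 p q \<subseteq> {0}"
    by (auto simp: boundary_lead_eq)
  then show ?thesis
    using subspace_0[OF subspace_boundary_lead] by blast
qed

lemma boundary_lead_1: "boundary_lead 1 p q = d1 D ` bideg D (q - 1) p"
proof -
  have "component D q p (diff D y) = d1 D (component D (q - 1) p y)"
    if "y \<in> Zc D 0 p (q - 1)" for y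
    using that by (simp add: component_diff_eq Zc_component_eq_0)
  then have "boundary_lead 1 p q = d1 D ` cocycle_lead 0 p (q - 1)"
    by (simp add: boundary_lead_eq cocycle_lead_def image_image cong: image_cong_simp)
  then show ?thesis by (simp add: cocycle_lead_0)
qed

text \<open>This is the kernel half of the passage to cohomology: subtracting a cochain
  \<open>y\<close> of higher filtration cancels the leading component of \<open>diff D z\<close>
  without changing that of \<open>z\<close>.\<close>

lemma cocycle_lead_succI:
  assumes z: "z \<in> Zc D s p q"
    and "component D (q + 1 - s) (p + s) (diff D z) \<in> boundary_lead s (p + s) (q + 1 - s)"
  shows "component D q p z \<in> cocycle_lead (s + 1) p q"
proof -
  obtain y where y: "y \<in> Zc D (s - 1) (p + 1) (q - 1)"
    and eq: "component D (q + 1 - s) (p + s) (diff D z) =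
      component D (q + 1 - s) (p + s) (diff D y)"
    using assms(2) by (auto simp: boundary_lead_eq)
  have zy: "z - y \<in> Zc D s p q"
    using Zc_shift[of "s - 1" p q] y by (auto intro: subspace_diff[OF subspace_Zc z])
  have "component D a b (diff D (z - y)) = 0" if "b < p + (s + 1)" for a b
  proof (cases "b = p + s \<and> a = q + 1 - s")
    case True
    then show ?thesis using eq by (simp add: diff_minus component_diff)
  next
    case False
    then show ?thesis
      using that by (intro Zc_component_eq_0[OF diff_mem_Zc[OF zy]]) auto
  qed
  then have "z - y \<in> Zc D (s + 1) p q"
    using zy unfolding mem_Zc by blast
  moreover have "component D q p (z - y) = component D q p z"
    using Zc_component_eq_0[OF y, of p q] by (simp add: component_diff)
  ultimately show ?thesis
    unfolding cocycle_lead_def by (metis image_eqI)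
qed

text \<open>The equations of the system make the sum telescope: each \<open>d2\<close> term cancels
  the next \<open>d1\<close> term, the first \<open>d1\<close> term is zero, and the last
  \<open>d2\<close> term survives.\<close>

lemma solves_S_diff_sum:
  assumes "solves_S D p q z (Suc k) zs"
  shows "diff D (\<Sum>i<Suc k. zs i) = d2 D (zs k)"
  using assms
proof (induction k)
  case 0
  then show ?case by (simp add: solves_S_def diff_split)
next
  case (Suc k)
  from Suc.prems have "solves_S D p q z (Suc k) zs"
    by (simp add: solves_S_def)
  then have "diff D (\<Sum>i<Suc k. zs i) = d2 D (zs k)"
    by (rule Suc.IH)
  moreover have "d2 D (zs k) + d1 D (zs (Suc k)) = 0"
    using Suc.prems by (force simp: solves_S_def)
  ultimately show ?case
    unfolding sum.lessThan_Suc[of _ "Suc k"] diff_add diff_split[of "zs (Suc k)"]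
    by (simp flip: add.assoc)
qed

lemma solves_S_last_mem:
  assumes "solves_S D p q z (Suc k) zs"
  shows "d2 D (zs k) \<in> bideg D (q + 1 - 2 * int (Suc k)) (p + 2 * int (Suc k))"
proof -
  have "zs k \<in> bideg D (q - 2 * int k) (p + 2 * int k)"
    using assms by (simp add: solves_S_def)
  from diff_comp_mem[OF this, of "- 1" 2] show ?thesis
    by (simp add: algebra_simps)
qed

lemma solves_S_component:
  assumes "solves_S D p q z (Suc k) zs"
  shows "component D a b (\<Sum>i<Suc k. zs i) =
    (\<Sum>i<Suc k. if a = q - 2 * int i \<and> b = p + 2 * int i then zs i else 0)"
proof -
  have "zs i \<in> bideg D (q - 2 * int i) (p + 2 * int i)" if "i < Suc k" for i
    using assms that by (simp add: solves_S_def)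
  then show ?thesis
    unfolding component_sum by (intro sum.cong) (simp_all add: component_bideg)
qed

lemma solves_S_lead:
  assumes "solves_S D p q z (Suc k) zs"
  shows "component D q p (\<Sum>i<Suc k. zs i) = z"
proof -
  have "component D q p (\<Sum>i<Suc k. zs i) = (\<Sum>i<Suc k. if i = 0 then zs i else 0)"
    unfolding solves_S_component[OF assms] by (rule sum.cong) auto
  then show ?thesis
    using assms by (simp add: solves_S_def sum.delta)
qed

text \<open>The differential of the sum is the single term \<open>d2 D (zs k)\<close> in filtration
  \<open>p + 2 * (k + 1)\<close>. Hence one solution serves both pages \<open>2 * k + 1\<close> and
  \<open>2 * k + 2\<close>.\<close>

lemma solves_S_mem_Zc:
  assumes S: "solves_S D p q z (Suc k) zs" and "s \<le> 2 * int (Suc k)"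
  shows "(\<Sum>i<Suc k. zs i) \<in> Zc D s p q"
  unfolding mem_Zc
proof (intro conjI allI impI)
  fix a b
  assume "component D a b (\<Sum>i<Suc k. zs i) \<noteq> 0"
  then obtain i where "a = q - 2 * int i" "b = p + 2 * int i"
    unfolding solves_S_component[OF S]
    by (elim sum.not_neutral_contains_not_neutral) (simp split: if_splits)
  then show "p \<le> b" "a + b = p + q" by auto
next
  fix a b assume "b < p + s"
  then show "component D a b (diff D (\<Sum>i<Suc k. zs i)) = 0"
    unfolding solves_S_diff_sum[OF S] component_bideg[OF solves_S_last_mem[OF S]]
    using assms(2) by auto
qed

text \<open>Equation \<open>j\<close> of the system is the vanishing of \<open>diff D z\<close> in
  bidegree \<open>(q - 2 * j + 1, p + 2 * j)\<close>. The last one, \<open>j = k\<close>, requires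
  level \<open>2 * k + 1\<close>.\<close>

lemma Zc_solves_S:
  assumes z: "z \<in> Zc D s p q" and s: "2 * int k + 1 \<le> s"
  shows "solves_S D p q (component D q p z) (Suc k)
    (\<lambda>j. component D (q - 2 * int j) (p + 2 * int j) z)"
  unfolding solves_S_def
proof (intro conjI ballI allI impI)
  show "d1 D (component D q p z) = 0"
    using Zc_diff_component_eq_0[OF z, of p "q + 1"] Zc_component_eq_0[OF z, of "p - 2" "q + 2"] s
    by (simp add: component_diff_eq add.commute)
next
  fix j assume j: "j \<in> {1..Suc k - 1}"
  then have "component D (q - 2 * int j + 1) (p + 2 * int j) (diff D z) = 0"
    using s by (intro Zc_diff_component_eq_0[OF z]) auto
  moreover have "int (j - 1) = int j - 1" using j by auto
  ultimately show "d2 D (component D (q - 2 * int (j - 1)) (p + 2 * int (j - 1)) z) +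
      d1 D (component D (q - 2 * int j) (p + 2 * int j) z) = 0"
    by (simp add: component_diff_eq algebra_simps)
qed (simp_all add: component_mem)

lemma cocycle_lead_1: "cocycle_lead 1 p q = {z \<in> bideg D q p. d1 D z = 0}"
proof (intro equalityI subsetI)
  fix x assume "x \<in> cocycle_lead 1 p q"
  then obtain z where "z \<in> Zc D 1 p q" "x = component D q p z"
    by (auto simp: cocycle_lead_def)
  then show "x \<in> {z \<in> bideg D q p. d1 D z = 0}"
    using Zc_solves_S[of z 1 p q 0] by (simp add: component_mem solves_S_def)
next
  fix x assume "x \<in> {z \<in> bideg D q p. d1 D z = 0}"
  then have "solves_S D p q x (Suc 0) (\<lambda>_. x)"
    by (simp add: solves_S_def)
  from solves_S_mem_Zc[OF this, of 1] solves_S_lead[OF this]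
  show "x \<in> cocycle_lead 1 p q"
    by (force simp: cocycle_lead_def)
qed

lemma Zc_eq_sum:
  assumes z: "z \<in> Zc D s p q"
  shows "z = (\<Sum>i=0..q. component D (q - i) (p + i) z)"
proof (rule component_eqI)
  fix a b
  have "component D a b (\<Sum>i=0..q. component D (q - i) (p + i) z) =
      (\<Sum>i=0..q. if i = b - p then if a + b = p + q then component D a b z else 0 else 0)"
    unfolding component_sum
  proof (rule sum.cong[OF refl])
    fix i
    have "a = q - i \<and> b = p + i \<longleftrightarrow> i = b - p \<and> a + b = p + q" by auto
    then show "component D a b (component D (q - i) (p + i) z) =
        (if i = b - p then if a + b = p + q then component D a b z else 0 else 0)"
      unfolding component_bideg[OF component_mem] by auto
  qed
  also have "\<dots> = (if b - p \<in> {0..q} \<and> a + b = p + q then component D a b z else 0)"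
    by (simp add: sum.delta)
  also have "\<dots> = component D a b z"
  proof -
    have "component D a b z = 0" if "\<not> (b - p \<in> {0..q} \<and> a + b = p + q)"
    proof -
      \<comment> \<open>Below the range the filtration kills the component; above it, the total
        degree forces \<open>a < 0\<close>. For negative \<open>q\<close> the sum is empty and
        \<open>z\<close> is zero.\<close>
      have "(b < p \<or> a + b \<noteq> p + q) \<or> (a < 0 \<or> b < 0)"
        using that by (simp, linarith)
      then show ?thesis
        using Zc_component_eq_0[OF z] component_neg_degree by blast
    qed
    then show ?thesis by presburger
  qed
  finally show "component D a b z =
      component D a b (\<Sum>i=0..q. component D (q - i) (p + i) z)" by simp
qed

section \<open>Iterated cohomology classes as cosets modulo leading components of boundaries\<close>

lemma merged_class_coset:
  assumes "subspace N" "subspace N'" "N \<subseteq> N'"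
  shows "merged_class ((\<lambda>n. n +o N) ` N') (z +o N) = z +o N'"
proof -
  have "merged_class ((\<lambda>n. n +o N) ` N') (z +o N) = (\<Union>n\<in>N'. (z + n) +o N)"
    by (simp only: merged_class_def Setcompr_eq_image image_image coset_add_coset[OF assms(1)])
  also have "\<dots> = z +o N'"
  proof (intro equalityI subsetI)
    fix x assume "x \<in> (\<Union>n\<in>N'. (z + n) +o N)"
    then show "x \<in> z +o N'"
      using assms(3) subspace_add[OF assms(2)]
      by (auto simp: elt_set_plus_def add.assoc)
  next
    fix x assume "x \<in> z +o N'"
    then obtain n where "n \<in> N'" "x = (z + n) + 0" by (auto simp: elt_set_plus_def)
    then show "x \<in> (\<Union>n\<in>N'. (z + n) +o N)"
      using subspace_0[OF assms(1)] unfolding elt_set_plus_def by blast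
  qed
  finally show ?thesis .
qed

lemma boundary_lead_pair:
  "s \<in> {2 * k + 1, 2 * k + 2} \<Longrightarrow> boundary_lead (int s) p q = boundary_lead (2 * int k + 1) p q"
proof -
  assume "s \<in> {2 * k + 1, 2 * k + 2}"
  then have "int s = 2 * int k + 1 \<or> int s = 2 * int k + 1 + 1" by auto
  moreover have "odd (2 * int k + 1)" by simp
  ultimately show ?thesis using boundary_lead_odd by metis
qed

lemma cocycle_lead_pair:
  "s \<in> {2 * k + 1, 2 * k + 2} \<Longrightarrow> cocycle_lead (int s) p q = cocycle_lead (2 * int k + 1) p q"
proof -
  assume "s \<in> {2 * k + 1, 2 * k + 2}"
  then have "int s = 2 * int k + 1 \<or> int s = 2 * int k + 1 + 1" by auto
  moreover have "odd (2 * int k + 1)" by simp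
  ultimately show ?thesis using cocycle_lead_odd by metis
qed

lemma page_model_0: "page_model D 0 (\<lambda>p q z. z)"
  by unfold_locales (simp add: boundary_lead_0)

lemma page_model_coset:
  assumes "s \<in> {2 * k + 1, 2 * k + 2}"
  shows "page_model D s (\<lambda>p q z. z +o boundary_lead (2 * int k + 1) p q)"
  by unfold_locales (simp add: boundary_lead_pair[OF assms] coset_eq_iff subspace_boundary_lead)

text \<open>The two claims are proved together because the recursion is mutual. Step
  \<open>Suc k\<close> takes cohomology on page \<open>s = 2 * k + 2\<close>, which leads to level
  \<open>s + 1 = 2 * Suc k + 1\<close>.\<close>

lemma iter_eq:
  "iter_class D k = (\<lambda>p q z. z +o boundary_lead (2 * int k + 1) p q) \<and>
   iter_coh D k = (\<lambda>p q. iter_class D k p q ` cocycle_lead (2 * int k + 1) p q)"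
proof (induction k)
  case 0
  show ?case by (simp add: boundary_lead_1 cocycle_lead_1)
next
  case (Suc k)
  define s where "s = 2 * Suc k"
  define c where "c = (\<lambda>p q z. z +o boundary_lead (2 * int k + 1) p q)"
  have s: "s \<in> {2 * k + 1, 2 * k + 2}" and s': "2 * int (Suc k) + 1 = int s + 1"
    by (auto simp: s_def)
  interpret page_model D s c
    unfolding c_def by (rule page_model_coset[OF s])
  have ic: "iter_class D k = c" and ih: "iter_coh D k = (\<lambda>p q. c p q ` cocycle_lead (int s) p q)"
    using Suc.IH by (simp_all add: c_def cocycle_lead_pair[OF s])
  have c: "c p q z = z +o boundary_lead (int s) p q" for p q z
    by (simp add: c_def boundary_lead_pair[OF s])
  \<comment> \<open>The representatives run through exactly those cochains whose differentials give
    the leading boundaries of level \<open>s + 1\<close>.\<close>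
  have range: "transport D c s (p - int s) (q - 1 + int s) ` iter_coh D k (p - int s) (q - 1 + int s)
      = (\<lambda>n. n +o boundary_lead (int s) p q) ` boundary_lead (int s + 1) p q" for p q
  proof -
    have "transport D c s (p - int s) (q - 1 + int s) ` iter_coh D k (p - int s) (q - 1 + int s)
        = (\<lambda>z. c p q (component D q p (diff D z))) ` Zc D (int s) (p - int s) (q - 1 + int s)"
      unfolding ih cocycle_lead_def image_image
      by (rule image_cong[OF refl]) (simp add: transport_eq)
    also have "\<dots> = c p q ` boundary_lead (int s + 1) p q"
      by (simp add: boundary_lead_eq image_image algebra_simps)
    finally show ?thesis by (simp add: c)
  qed
  \<comment> \<open>This is the third isomorphism theorem: dividing by \<open>N\<^sub>s\<close> and
    then by the image amounts to dividing by the leading boundaries of level \<open>s + 1\<close> at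
    once.\<close>
  have merged: "merged_class
      (transport D c s (p - int s) (q - 1 + int s) ` iter_coh D k (p - int s) (q - 1 + int s))
      (c p q z) = z +o boundary_lead (int s + 1) p q" for p q z
    unfolding range unfolding c
    by (intro merged_class_coset subspace_boundary_lead boundary_lead_mono)
  \<comment> \<open>One inclusion corrects the representative by \<open>cocycle_lead_succI\<close>;
    for the other, a cocycle of level \<open>s + 1\<close> has differential without component in
    filtration \<open>p + s\<close>.\<close>
  have kernel: "{X \<in> iter_coh D k p q. transport D c s p q X = c (p + int s) (q + 1 - int s) 0}
      = c p q ` cocycle_lead (int s + 1) p q" for p q
  proof (intro equalityI subsetI)
    fix X
    assume X: "X \<in> {X \<in> iter_coh D k p q. transport D c s p q X = c (p + int s) (q + 1 - int s) 0}"
    then obtain z where z: "z \<in> Zc D (int s) p q" and Xz: "X = c p q (component D q p z)"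
      by (auto simp: ih cocycle_lead_def)
    have "component D (q + 1 - int s) (p + int s) (diff D z)
        \<in> boundary_lead (int s) (p + int s) (q + 1 - int s)"
      using X by (simp add: Xz transport_eq[OF z] c_eq_iff)
    from cocycle_lead_succI[OF z this] show "X \<in> c p q ` cocycle_lead (int s + 1) p q"
      by (simp add: Xz)
  next
    fix X assume "X \<in> c p q ` cocycle_lead (int s + 1) p q"
    then obtain z where z: "z \<in> Zc D (int s + 1) p q" and Xz: "X = c p q (component D q p z)"
      by (auto simp: cocycle_lead_def)
    have zs: "z \<in> Zc D (int s) p q"
      using z Zc_antimono[of "int s" "int s + 1"] by auto
    then show "X \<in> {X \<in> iter_coh D k p q. transport D c s p q X = c (p + int s) (q + 1 - int s) 0}"
      using Zc_diff_component_eq_0[OF z, of "p + int s"]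
      by (simp add: Xz transport_eq[OF zs] ih cocycle_lead_def)
  qed
  have class_Suc: "iter_class D (Suc k) = (\<lambda>p q z. z +o boundary_lead (int s + 1) p q)"
    by (simp only: iter_class.simps Let_def s_def[symmetric] ic merged)
  moreover have "iter_coh D (Suc k) = (\<lambda>p q. iter_class D (Suc k) p q ` cocycle_lead (int s + 1) p q)"
    unfolding class_Suc
    by (simp only: iter_coh.simps Let_def s_def[symmetric] ic kernel image_image merged)
  ultimately show ?case unfolding s' by blast
qed

lemma iter_class_eq: "iter_class D k p q z = z +o boundary_lead (2 * int k + 1) p q"
  using iter_eq by simp

lemma iter_coh_eq: "iter_coh D k p q = iter_class D k p q ` cocycle_lead (2 * int k + 1) p q"
  using iter_eq by metis

lemma page_model_iter: "s \<in> {2 * k + 1, 2 * k + 2} \<Longrightarrow> page_model D s (iter_class D k)"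
  using page_model_coset iter_eq by simp

text \<open>As leading boundaries are leading cocycles, membership does not depend on the
  representative of the coset.\<close>

lemma iter_class_mem_iff:
  "iter_class D k p q z \<in> iter_coh D k p q \<longleftrightarrow> z \<in> cocycle_lead (2 * int k + 1) p q"
proof
  assume "iter_class D k p q z \<in> iter_coh D k p q"
  then obtain z' where z': "z' \<in> cocycle_lead (2 * int k + 1) p q"
    and "z - z' \<in> boundary_lead (2 * int k + 1) p q"
    by (auto simp: iter_coh_eq iter_class_eq coset_eq_iff subspace_boundary_lead)
  then have "z' + (z - z') \<in> cocycle_lead (2 * int k + 1) p q"
    using boundary_lead_subset by (blast intro: subspace_add[OF subspace_cocycle_lead])
  then show "z \<in> cocycle_lead (2 * int k + 1) p q" by simp
qed (simp add: iter_coh_eq)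

section \<open>The models and transported differentials of all pages\<close>

lemma page_0_model:
  shows "z \<in> Zc D 0 p q \<Longrightarrow> I0 D p q (page_class D 0 p q z) = component D q p z"
    and "linear_bij (coset_scale (scl D)) (page D 0 p q) (scl D) (bideg D q p) (I0 D p q)"
    and "z \<in> bideg D q p \<Longrightarrow> dbar0 D p q z = d1 D z"
proof -
  interpret page_model D 0 "\<lambda>p q z. z" by (rule page_model_0)
  show "I0 D p q (page_class D 0 p q z) = component D q p z"
    by (simp add: I0_def class_map_page_class)
  show "linear_bij (coset_scale (scl D)) (page D 0 p q) (scl D) (bideg D q p) (I0 D p q)"
    using linear_bij_class_map[where p = p and q = q and scl' = "scl D"]
    by (simp add: I0_def cocycle_lead_0)
  show "dbar0 D p q z = d1 D z" if z: "z \<in> bideg D q p"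
  proof -
    have "z \<in> Zc D (int 0) p q" using z bideg_subset_Zc by auto
    from transport_eq[OF this] show ?thesis
      by (simp add: dbar0_def component_bideg[OF z] component_diff_eq)
  qed
qed

text \<open>Treating pages \<open>2 * k + 1\<close> and \<open>2 * k + 2\<close> together gives the
  coincidence of their models and isomorphisms.\<close>

lemma page_pos_model:
  assumes s: "s \<in> {2 * k + 1, 2 * k + 2}"
  shows "I_map D s p q (page_class D s p q z) = iter_class D k p q (component D q p z)"
    and "linear_bij (coset_scale (scl D)) (page D s p q)
      (coset_scale (scl D)) (iter_coh D k p q) (I_map D s p q)"
    and "iter_class D k p q z \<in> iter_coh D k p q \<Longrightarrow> \<exists>zs. solves_S D p q z (Suc k) zs"
    and "solves_S D p q z (Suc k) zs \<Longrightarrow> (\<Sum>i<Suc k. zs i) \<in> Zc D (int s) p q"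
    and "solves_S D p q z (Suc k) zs \<Longrightarrow>
      inv_into (page D s p q) (I_map D s p q) (iter_class D k p q z)
        = page_class D s p q (\<Sum>i<Suc k. zs i)"
proof -
  interpret page_model D s "iter_class D k" by (rule page_model_iter[OF s])
  have "(s - 1) div 2 = k" using s by auto
  then have I: "I_map D s = class_map D (iter_class D k)" by (simp add: I_map_def)
  show "I_map D s p q (page_class D s p q z) = iter_class D k p q (component D q p z)"
    by (simp add: I class_map_page_class)
  have "linear_bij (coset_scale (scl D)) (page D s p q) (coset_scale (scl D))
      (iter_class D k p q ` cocycle_lead (int s) p q) (class_map D (iter_class D k) p q)"
    by (rule linear_bij_class_map)
      (simp_all add: iter_class_eq coset_add_coset coset_scale_coset subspace_boundary_lead)
  then show "linear_bij (coset_scale (scl D)) (page D s p q)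
      (coset_scale (scl D)) (iter_coh D k p q) (I_map D s p q)"
    by (simp add: I iter_coh_eq cocycle_lead_pair[OF s])
  show "\<exists>zs. solves_S D p q z (Suc k) zs" if "iter_class D k p q z \<in> iter_coh D k p q"
    using that Zc_solves_S[of _ "2 * int k + 1" p q k]
    unfolding iter_class_mem_iff cocycle_lead_def by blast
  assume S: "solves_S D p q z (Suc k) zs"
  show mem: "(\<Sum>i<Suc k. zs i) \<in> Zc D (int s) p q"
    using s by (intro solves_S_mem_Zc[OF S]) auto
  show "inv_into (page D s p q) (I_map D s p q) (iter_class D k p q z)
      = page_class D s p q (\<Sum>i<Suc k. zs i)"
    using inv_class_map[OF mem] unfolding solves_S_lead[OF S] by (simp add: I)
qed

text \<open>By \<open>cocycle_lead_odd\<close> the class has a representative of level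
  \<open>2 * k + 2\<close>, whose differential vanishes in the one bidegree that matters.\<close>

lemma dbar_odd:
  assumes "X \<in> iter_coh D k p q"
  shows "dbar D (2 * k + 1) p q X =
    iter_class D k (p + int (2 * k + 1)) (q + 1 - int (2 * k + 1)) 0"
proof -
  interpret page_model D "2 * k + 1" "iter_class D k" by (rule page_model_iter) simp
  have "cocycle_lead (int (2 * k + 1) + 1) p q = cocycle_lead (2 * int k + 1) p q"
    using cocycle_lead_odd[of "int (2 * k + 1)" p q] by (simp add: add.commute)
  then have "X \<in> iter_class D k p q ` cocycle_lead (int (2 * k + 1) + 1) p q"
    using assms unfolding iter_coh_eq by metis
  then obtain z where z: "z \<in> Zc D (int (2 * k + 1) + 1) p q"
    and X: "X = iter_class D k p q (component D q p z)"
    unfolding cocycle_lead_def by blast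
  have "z \<in> Zc D (int (2 * k + 1)) p q"
    using z Zc_antimono[of "int (2 * k + 1)" "int (2 * k + 1) + 1"] by auto
  from transport_eq[OF this] show ?thesis
    unfolding X dbar_def
    using Zc_diff_component_eq_0[OF z, of "p + int (2 * k + 1)"] by simp
qed

text \<open>The sum of the solution is taken as representative. Its differential
  \<open>d2 D (zs k)\<close> is homogeneous of the target bidegree, hence its own leading
  component.\<close>

lemma dbar_even:
  assumes S: "solves_S D p q z (Suc k) zs"
  shows "dbar D (2 * Suc k) p q (iter_class D k p q z) =
    iter_class D k (p + int (2 * Suc k)) (q + 1 - int (2 * Suc k)) (d2 D (zs k))"
proof -
  interpret page_model D "2 * Suc k" "iter_class D k" by (rule page_model_iter) simp
  have "(\<Sum>i<Suc k. zs i) \<in> Zc D (int (2 * Suc k)) p q"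
    by (rule solves_S_mem_Zc[OF S]) simp
  from transport_eq[OF this] show ?thesis
    unfolding solves_S_lead[OF S] solves_S_diff_sum[OF S]
    using component_bideg[OF solves_S_last_mem[OF S]] by (simp add: dbar_def)
qed

end

theorem proposition1:
  fixes D :: "('a::field, 'v::ab_group_add) double_complex"
  assumes "vpdc D"
    and "\<And>x. diff D x = d1 D x + d2 D x"
  shows
    "(\<forall>p q.
        (\<forall>z\<in>Zc D 0 p q.
           z = (\<Sum>i=0..q. component D (q - i) (p + i) z) \<and>
           I0 D p q (page_class D 0 p q z) = component D q p z) \<and>
        linear_bij (coset_scale (scl D)) (page D 0 p q) (scl D) (bideg D q p) (I0 D p q) \<and>
        (\<forall>z\<in>bideg D q p. dbar0 D p q z = d1 D z))
     \<and>
     (\<forall>r\<ge>1. \<forall>p q.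
        (\<forall>s\<in>{2 * r - 1, 2 * r}.
           (\<forall>z\<in>Zc D (int s) p q.
              z = (\<Sum>i=0..q. component D (q - i) (p + i) z) \<and>
              I_map D s p q (page_class D s p q z) = iter_class D (r - 1) p q (component D q p z)) \<and>
           linear_bij (coset_scale (scl D)) (page D s p q)
             (coset_scale (scl D)) (iter_coh D (r - 1) p q) (I_map D s p q) \<and>
           (\<forall>z\<in>bideg D q p. iter_class D (r - 1) p q z \<in> iter_coh D (r - 1) p q \<longrightarrow>
              (\<exists>zs. solves_S D p q z r zs) \<and>
              (\<forall>zs. solves_S D p q z r zs \<longrightarrow>
                 (\<Sum>i<r. zs i) \<in> Zc D (int s) p q \<and>
                 inv_into (page D s p q) (I_map D s p q) (iter_class D (r - 1) p q z)
                   = page_class D s p q (\<Sum>i<r. zs i)))) \<and>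
        (\<forall>X\<in>iter_coh D (r - 1) p q.
           dbar D (2 * r - 1) p q X
             = iter_class D (r - 1) (p + int (2 * r - 1)) (q + 1 - int (2 * r - 1)) 0) \<and>
        (\<forall>z\<in>bideg D q p. iter_class D (r - 1) p q z \<in> iter_coh D (r - 1) p q \<longrightarrow>
           (\<forall>zs. solves_S D p q z r zs \<longrightarrow>
              dbar D (2 * r) p q (iter_class D (r - 1) p q z)
                = iter_class D (r - 1) (p + int (2 * r)) (q + 1 - int (2 * r))
                    (d2 D (zs (r - 1))))))"
proof -
  interpret two_term_vpdc D
    using assms by (simp add: two_term_vpdc_def two_term_vpdc_axioms_def)
  show ?thesis
  proof (intro conjI allI impI)
    fix r :: nat and p q :: int
    assume "1 \<le> r"
    then obtain k where r: "r = Suc k" by (cases r) auto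
    have rk: "r - 1 = k" "2 * r - 1 = 2 * k + 1" using r by auto
    have s: "s \<in> {2 * k + 1, 2 * k + 2}" if "s \<in> {2 * r - 1, 2 * r}" for s
      using that r by auto
    note model = page_pos_model[OF s]
    show "\<forall>s\<in>{2 * r - 1, 2 * r}.
           (\<forall>z\<in>Zc D (int s) p q.
              z = (\<Sum>i=0..q. component D (q - i) (p + i) z) \<and>
              I_map D s p q (page_class D s p q z) = iter_class D (r - 1) p q (component D q p z)) \<and>
           linear_bij (coset_scale (scl D)) (page D s p q)
             (coset_scale (scl D)) (iter_coh D (r - 1) p q) (I_map D s p q) \<and>
           (\<forall>z\<in>bideg D q p. iter_class D (r - 1) p q z \<in> iter_coh D (r - 1) p q \<longrightarrow>
              (\<exists>zs. solves_S D p q z r zs) \<and>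
              (\<forall>zs. solves_S D p q z r zs \<longrightarrow>
                 (\<Sum>i<r. zs i) \<in> Zc D (int s) p q \<and>
                 inv_into (page D s p q) (I_map D s p q) (iter_class D (r - 1) p q z)
                   = page_class D s p q (\<Sum>i<r. zs i)))"
      unfolding rk(1) unfolding r
      by (intro ballI conjI allI impI; (rule Zc_eq_sum model; (assumption | simp add: r)))
    show "\<forall>X\<in>iter_coh D (r - 1) p q.
           dbar D (2 * r - 1) p q X
             = iter_class D (r - 1) (p + int (2 * r - 1)) (q + 1 - int (2 * r - 1)) 0"
      unfolding rk by (intro ballI dbar_odd)
    show "\<forall>z\<in>bideg D q p. iter_class D (r - 1) p q z \<in> iter_coh D (r - 1) p q \<longrightarrow>
           (\<forall>zs. solves_S D p q z r zs \<longrightarrow>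
              dbar D (2 * r) p q (iter_class D (r - 1) p q z)
                = iter_class D (r - 1) (p + int (2 * r)) (q + 1 - int (2 * r))
                    (d2 D (zs (r - 1))))"
      unfolding rk(1) unfolding r by (intro ballI allI impI dbar_even)
  \<comment> \<open>Only the claims on page 0 remain.\<close>
  qed (intro ballI conjI Zc_eq_sum page_0_model; assumption)+
qed

end
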